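(* Let $(N,\mathbf{w},P,\mathbf{u})$ be a team formation model such that for all $x,x'\in X$ with $x'\neq x$ and $x'=x\cup\{p\}$ for some $p\in P$, and all $i\in n(p)$, one has $u_i(x')>u_i(x)$. Take a (myopic) team-wise dynamics and either a uniform destructive perturbation scheme or a uniform perturbation scheme, and let $SS$ be the set of stochastically stable states. Then $$SS=\mathcal{L},$$ where $\mathcal{L}=\{x\in X: |x|\ge |x'| \text{ for all } x'\in X\}$ is the set of feasible states with the maximum number of completed projects.
   Context: Team formation model. $N$ is a finite set of $n$ agents; $\mathbf{w}\in\mathbb{N}_+^n$ is the vector of time endowments ($\mathbb{N}_+$ = positive integers, $\mathbb{N}$ = non-negative integers). A team is a vector $\mathbf{t}\in\mathbb{N}^n$ with $\mathbf{t}\le\mathbf{w}$ componentwise; $T$ is the set of teams. $A$ is a finite set of activities. A project is a pair $p=(a,\mathbf{t})\in A\times T$; the technology is a given set $P\subseteq A\times T$. For $p=(a,\mathbf{t})$, $n(p)=\{i\in N: t_i>0\}$. A state is a collection of projects $x\subseteq P$ in which every activity is performed by only one team (no two projects in $x$ with different teams have the same activity); $\mathbf{e}(x)=\sum_{(a,\mathbf{t})\in x}\mathbf{t}$; a state $x$ is feasible if $\mathbf{e}(x)\le\mathbf{w}$; $X$ is the set of all feasible states. Each agent $i$ has a utility function $u_i:X\to\mathbb{R}$, and $\mathbf{u}=(u_i)_{i\in N}$. Myopic team-wise dynamics: the discrete-time Markov chain on $X$ in which, in each period, from current state $x$, a single project $p\in P$ is drawn, every project in $P$ having positive probability of being drawn;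 the project is formed, so that the next state is $x\cup\{p\}$, if $x\cup\{p\}$ is feasible, and otherwise it is not formed and the state remains $x$. Perturbations are added to this dynamics as follows, with $\epsilon>0$ and $x^s$ the state at time $s$. Uniform perturbation scheme: at every time $s$ each project $p\in P$ is subject, with i.i.d. probability $\epsilon$, to an error, which makes the project disappear if existing, and be formed if non-existing and $x^s\cup\{p\}\in X$. Uniform destructive perturbation scheme: only existing projects can be hit, and each existing project disappears with i.i.d. probability $\epsilon$. The perturbed chain is irreducible and aperiodic, hence has a unique stationary distribution $\pi^\epsilon$. A state is stochastically stable if it has positive probability in the limit of $\pi^\epsilon$ as $\epsilon\to 0$. *)

theory Defs
  imports "HOL-Probability.Probability"
begin

text \<open>Teams are represented by functions on the agent type that vanish outside the set of
  agents, so that each vector of contributions has exactly one representative.\<close>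

type_synonym 'i team = "'i \<Rightarrow> nat"
type_synonym ('a, 'i) project = "'a \<times> 'i team"
type_synonym ('a, 'i) state = "('a, 'i) project set"

definition teams :: "'i set \<Rightarrow> ('i \<Rightarrow> nat) \<Rightarrow> 'i team set" where
  "teams N w = {t. (\<forall>i\<in>N. t i \<le> w i) \<and> (\<forall>i. i \<notin> N \<longrightarrow> t i = 0)}"

text \<open>Utilities carry no constraint beyond their type, so they are not a parameter here;
  only their values on feasible states are ever used.\<close>

definition team_formation_model ::
    "'i set \<Rightarrow> ('i \<Rightarrow> nat) \<Rightarrow> 'a set \<Rightarrow> ('a, 'i) project set \<Rightarrow> bool" where
  "team_formation_model N w A P \<longleftrightarrow>
     finite N \<and> (\<forall>i\<in>N. 0 < w i) \<and> finite A \<and> P \<subseteq> A \<times> teams N w"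

definition members :: "'i set \<Rightarrow> ('a, 'i) project \<Rightarrow> 'i set" where
  "members N p = {i \<in> N. 0 < snd p i}"

definition effort :: "('a, 'i) state \<Rightarrow> 'i \<Rightarrow> nat" where
  "effort x i = (\<Sum>(a, t)\<in>x. t i)"

definition states :: "('a, 'i) project set \<Rightarrow> ('a, 'i) state set" where
  "states P = {x. x \<subseteq> P \<and> (\<forall>a t t'. (a, t) \<in> x \<longrightarrow> (a, t') \<in> x \<longrightarrow> t = t')}"

definition feasible_states ::
    "'i set \<Rightarrow> ('i \<Rightarrow> nat) \<Rightarrow> ('a, 'i) project set \<Rightarrow> ('a, 'i) state set" where
  "feasible_states N w P = {x \<in> states P. \<forall>i\<in>N. effort x i \<le> w i}"

definition max_size_states :: "'p set set \<Rightarrow> 'p set set" where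
  "max_size_states X = {x \<in> X. \<forall>x'\<in>X. card x' \<le> card x}"

text \<open>Below, \<open>X\<close> is always the set of feasible states. The distribution \<open>draw x\<close> of the drawn
  project may depend on the current state \<open>x\<close>, but always has full support.\<close>

definition full_support_draw :: "'p set \<Rightarrow> 'p set set \<Rightarrow> ('p set \<Rightarrow> 'p pmf) \<Rightarrow> bool" where
  "full_support_draw P X draw \<longleftrightarrow> (\<forall>x\<in>X. set_pmf (draw x) = P)"

definition teamwise_step :: "'p set set \<Rightarrow> ('p set \<Rightarrow> 'p pmf) \<Rightarrow> 'p set \<Rightarrow> 'p set pmf" where
  "teamwise_step X draw x = map_pmf (\<lambda>p. if x \<union> {p} \<in> X then x \<union> {p} else x) (draw x)"

text \<open>The random set of elements of \<open>S\<close> hit by independent errors of probability \<open>\<epsilon>\<close>.\<close>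

definition error_set :: "'p set \<Rightarrow> real \<Rightarrow> 'p set pmf" where
  "error_set S \<epsilon> = map_pmf (\<lambda>h. {p \<in> S. h p}) (Pi_pmf S False (\<lambda>_. bernoulli_pmf \<epsilon>))"

definition destructive_scheme :: "real \<Rightarrow> 'p set \<Rightarrow> 'p set pmf" where
  "destructive_scheme \<epsilon> x = map_pmf (\<lambda>E. x - E) (error_set x \<epsilon>)"

text \<open>When several non-existing projects are hit in the same period, each of them may be
  feasible on top of the current state although they are not jointly feasible. The
  specification of the errors does not say which of them are formed in that case, so
  this is left to a rule \<open>res\<close> (possibly random) about which nothing is assumed, except that
  it forms some subset of these projects and yields a feasible state. Whenever there
  is no such conflict, the outcome is forced.\<close>

definition formed_by_error :: "'p set set \<Rightarrow> 'p set \<Rightarrow> 'p set \<Rightarrow> 'p set" where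
  "formed_by_error X x E = {p \<in> E - x. x \<union> {p} \<in> X}"

definition error_outcome :: "'p set \<Rightarrow> 'p set set \<Rightarrow> ('p set \<Rightarrow> 'p set \<Rightarrow> 'p set pmf) \<Rightarrow> bool" where
  "error_outcome P X res \<longleftrightarrow>
     (\<forall>x\<in>X. \<forall>E\<subseteq>P. \<forall>y\<in>set_pmf (res x E).
        y \<in> X \<and> (\<exists>F\<subseteq>formed_by_error X x E. y = (x - E) \<union> F) \<and>
        ((x - E) \<union> formed_by_error X x E \<in> X \<longrightarrow> y = (x - E) \<union> formed_by_error X x E))"

definition uniform_scheme ::
    "'p set \<Rightarrow> ('p set \<Rightarrow> 'p set \<Rightarrow> 'p set pmf) \<Rightarrow> real \<Rightarrow> 'p set \<Rightarrow> 'p set pmf" where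
  "uniform_scheme P res \<epsilon> x = bind_pmf (error_set P \<epsilon>) (res x)"

text \<open>In each period the errors hit the current state, and then the team-wise step is taken
  from the resulting state.\<close>

definition perturbed_step ::
    "'p set set \<Rightarrow> ('p set \<Rightarrow> 'p pmf) \<Rightarrow> (real \<Rightarrow> 'p set \<Rightarrow> 'p set pmf) \<Rightarrow> real \<Rightarrow> 'p set \<Rightarrow> 'p set pmf" where
  "perturbed_step X draw err \<epsilon> x = bind_pmf (err \<epsilon> x) (teamwise_step X draw)"

definition stationary :: "'s set \<Rightarrow> ('s \<Rightarrow> 's pmf) \<Rightarrow> 's pmf \<Rightarrow> bool" where
  "stationary S K \<pi> \<longleftrightarrow> set_pmf \<pi> \<subseteq> S \<and> bind_pmf \<pi> K = \<pi>"

definition stationary_distribution :: "'s set \<Rightarrow> ('s \<Rightarrow> 's pmf) \<Rightarrow> 's pmf" where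
  "stationary_distribution S K = (THE \<pi>. stationary S K \<pi>)"

definition stochastically_stable :: "'s set \<Rightarrow> (real \<Rightarrow> 's \<Rightarrow> 's pmf) \<Rightarrow> 's set" where
  "stochastically_stable S K =
     {x \<in> S. \<exists>l>0. ((\<lambda>\<epsilon>. pmf (stationary_distribution S (K \<epsilon>)) x) \<longlongrightarrow> l) (at_right 0)}"

end

theory Submission
  imports Defs
begin

text \<open>Since every single project is feasible, the perturbed chain never returns to the empty
  state, and on the non-empty feasible states its \<open>n\<close>-step transition probability from \<open>x\<close> to
  \<open>y\<close> is, for large \<open>n\<close>, asymptotically a positive multiple of \<open>\<epsilon> ^ card (x - y)\<close>: each project
  of \<open>x - y\<close> must be destroyed by an error, and afterwards \<open>y\<close> can be completed for free. After
  multiplying the stationary weight of \<open>x\<close> by \<open>\<epsilon> ^ card x\<close> and dividing the transition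
  probabilities out of \<open>x\<close> by it, these get the order \<open>- card (x \<inter> y)\<close>, which is symmetric in \<open>x\<close>
  and \<open>y\<close>. Eliminating states one at a time needs no subtraction, hence preserves exact orders
  and also their symmetry, so that all rescaled weights have the same order. Therefore
  the stationary weight of \<open>x\<close> has the order \<open>m - card x\<close> with \<open>m\<close> the maximal size.\<close>

subsection \<open>State elimination for balance equations\<close>

text \<open>The outflow is written as a row sum, so rows of \<open>K\<close> need not sum to 1. This
  covers eliminated and row-rescaled kernels as well.\<close>

definition balanced :: "'s set \<Rightarrow> ('s \<Rightarrow> 's \<Rightarrow> real) \<Rightarrow> ('s \<Rightarrow> real) \<Rightarrow> bool" where
  "balanced S K p \<longleftrightarrow> (\<forall>y\<in>S. p y * (\<Sum>z\<in>S. K y z) = (\<Sum>x\<in>S. p x * K x y))"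

text \<open>This is the kernel watched only on \<open>T\<close> (a stochastic complement): a visit
  to \<open>s\<close> is resolved by its exit point. Dividing by the exit sum instead of
  \<open>1 - K s s\<close> avoids subtraction.\<close>

definition eliminate :: "'s \<Rightarrow> 's set \<Rightarrow> ('s \<Rightarrow> 's \<Rightarrow> real) \<Rightarrow> 's \<Rightarrow> 's \<Rightarrow> real" where
  "eliminate s T K x y = K x y + K x s * K s y / (\<Sum>z\<in>T. K s z)"

text \<open>After cancelling the diagonal term, the equation at \<open>s\<close> determines
  \<open>p s\<close>. Substituting this value turns the other columns into those of
  \<open>eliminate\<close>, while the total outflow of each remaining state is unchanged.\<close>

lemma balanced_insert_iff:
  assumes T: "finite T" "s \<notin> T" and d: "(\<Sum>z\<in>T. K s z) \<noteq> 0"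
  shows "balanced (insert s T) K p \<longleftrightarrow>
    balanced T (eliminate s T K) p \<and> p s = (\<Sum>x\<in>T. p x * K x s) / (\<Sum>z\<in>T. K s z)"
proof -
  define d where "d = (\<Sum>z\<in>T. K s z)"
  have d0: "d \<noteq> 0" using d by (simp add: d_def)
  have row: "(\<Sum>z\<in>T. eliminate s T K y z) = (\<Sum>z\<in>insert s T. K y z)" for y
  proof -
    have "(\<Sum>z\<in>T. eliminate s T K y z) = (\<Sum>z\<in>T. K y z) + (\<Sum>z\<in>T. K y s * K s z / d)"
      unfolding eliminate_def d_def[symmetric] by (simp add: sum.distrib)
    also have "(\<Sum>z\<in>T. K y s * K s z / d) = K y s * d / d"
      by (simp only: d_def sum_distrib_left sum_divide_distrib)
    finally show ?thesis using T d0 by simp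
  qed
  have col: "(\<Sum>x\<in>T. p x * eliminate s T K x y) = (\<Sum>x\<in>insert s T. p x * K x y)"
    if "p s = (\<Sum>x\<in>T. p x * K x s) / d" for y
  proof -
    have "(\<Sum>x\<in>T. p x * eliminate s T K x y)
        = (\<Sum>x\<in>T. p x * K x y) + (\<Sum>x\<in>T. p x * K x s) / d * K s y"
      unfolding eliminate_def d_def[symmetric]
      by (simp add: sum.distrib sum_distrib_left sum_distrib_right sum_divide_distrib algebra_simps)
    then show ?thesis using T that by simp
  qed
  have at_s: "p s * (\<Sum>z\<in>insert s T. K s z) = (\<Sum>x\<in>insert s T. p x * K x s)
      \<longleftrightarrow> p s = (\<Sum>x\<in>T. p x * K x s) / d"
    using T d0 by (simp add: d_def[symmetric] algebra_simps eq_divide_eq)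
  have "balanced (insert s T) K p \<longleftrightarrow> p s = (\<Sum>x\<in>T. p x * K x s) / d \<and>
      (\<forall>y\<in>T. p y * (\<Sum>z\<in>insert s T. K y z) = (\<Sum>x\<in>insert s T. p x * K x y))"
    unfolding balanced_def using at_s by (metis (no_types, lifting) insert_iff)
  also have "\<dots> \<longleftrightarrow> balanced T (eliminate s T K) p \<and> p s = (\<Sum>x\<in>T. p x * K x s) / d"
    unfolding balanced_def row by (metis (no_types, lifting) col)
  finally show ?thesis by (simp only: d_def)
qed

text \<open>Elimination keeps all entries positive, so induction on the state set applies, and the
  value at the removed state is then forced. Cross products express proportionality without naming
  the factor.\<close>

lemma balanced_ex_unique_upto_scaling:
  assumes "finite S" "S \<noteq> {}" "\<And>x y. x \<in> S \<Longrightarrow> y \<in> S \<Longrightarrow> 0 < K x y"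
  shows "\<exists>p. balanced S K p \<and> (\<forall>x\<in>S. 0 < p x) \<and>
    (\<forall>q. balanced S K q \<longrightarrow> (\<forall>x\<in>S. \<forall>y\<in>S. q x * p y = q y * p x))"
  using assms
proof (induction S arbitrary: K rule: finite_ne_induct)
  case (singleton s)
  then show ?case by (intro exI[of _ "\<lambda>_. 1"]) (simp add: balanced_def)
next
  case (insert s T)
  define d where "d = (\<Sum>z\<in>T. K s z)"
  have d: "d > 0" unfolding d_def using insert by (intro sum_pos) auto
  have el: "0 < eliminate s T K x y" if "x \<in> T" "y \<in> T" for x y
    unfolding eliminate_def d_def[symmetric] using insert.prems that d
    by (intro add_pos_pos divide_pos_pos mult_pos_pos) auto
  have "\<exists>p. balanced T (eliminate s T K) p \<and> (\<forall>x\<in>T. 0 < p x) \<and>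
    (\<forall>q. balanced T (eliminate s T K) q \<longrightarrow> (\<forall>x\<in>T. \<forall>y\<in>T. q x * p y = q y * p x))"
    by (rule insert.IH) (rule el)
  then obtain p where p: "balanced T (eliminate s T K) p" "\<forall>x\<in>T. 0 < p x"
    and u: "\<And>q x y. balanced T (eliminate s T K) q \<Longrightarrow> x \<in> T \<Longrightarrow> y \<in> T \<Longrightarrow> q x * p y = q y * p x"
    by blast
  define p' where "p' = p(s := (\<Sum>x\<in>T. p x * K x s) / d)"
  have p'T: "p' x = p x" if "x \<in> T" for x using that insert.hyps by (auto simp: p'_def)
  have p's: "p' s = (\<Sum>x\<in>T. p' x * K x s) / d"
    using p'T by (simp add: p'_def cong: sum.cong)
  have iff: "balanced (insert s T) K q \<longleftrightarrow>
    balanced T (eliminate s T K) q \<and> q s = (\<Sum>x\<in>T. q x * K x s) / d" for q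
    unfolding d_def by (rule balanced_insert_iff) (use insert.hyps d d_def in auto)
  have "balanced T (eliminate s T K) p'"
    using p(1) p'T by (simp add: balanced_def cong: sum.cong)
  then have b: "balanced (insert s T) K p'" using iff p's by blast
  have pos: "0 < p' x" if "x \<in> insert s T" for x
  proof (cases "x = s")
    case True
    then show ?thesis unfolding True p's using insert p(2) p'T d
      by (intro divide_pos_pos sum_pos mult_pos_pos) auto
  qed (use that p(2) p'T in auto)
  have "q x * p' y = q y * p' x"
    if q: "balanced (insert s T) K q" and xy: "x \<in> insert s T" "y \<in> insert s T" for q x y
  proof -
    have qT: "q x * p' y = q y * p' x" if "x \<in> T" "y \<in> T" for x y
      using u[of q x y] q iff that p'T by auto
    \<comment> \<open>Proportionality carries over from \<open>T\<close> to \<open>s\<close> because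
      the value at \<open>s\<close> is a fixed linear combination of the values on
      \<open>T\<close>.\<close>
    have qs: "q s * p' y = q y * p' s" if "y \<in> T" for y
    proof -
      have "q s * p' y = (\<Sum>x\<in>T. (q x * p' y) * K x s) / d"
        using q iff by (simp add: sum_distrib_right sum_distrib_left mult_ac)
      also have "\<dots> = (\<Sum>x\<in>T. (q y * p' x) * K x s) / d"
        using qT that by (simp cong: sum.cong)
      also have "\<dots> = q y * p' s" by (simp add: p's sum_distrib_left mult_ac)
      finally show ?thesis .
    qed
    show ?thesis using qT qs xy by (metis insert_iff mult.commute)
  qed
  then show ?case using b pos by blast
qed

subsection \<open>Exact orders as the error probability vanishes\<close>

text \<open>The exponent is real because rescaled transition weights may have negative orders. The
  strictly positive limit makes the order exact and stable under division.\<close>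

definition has_order :: "(real \<Rightarrow> real) \<Rightarrow> real \<Rightarrow> bool" where
  "has_order f k \<longleftrightarrow> (\<exists>c>0. ((\<lambda>\<epsilon>. f \<epsilon> / \<epsilon> powr k) \<longlongrightarrow> c) (at_right 0))"

lemma eventually_pos: "eventually (\<lambda>\<epsilon>::real. 0 < \<epsilon>) (at_right 0)"
  by (simp add: eventually_at_right_less)

lemma has_order_cong:
  assumes "eventually (\<lambda>\<epsilon>. f \<epsilon> = g \<epsilon>) (at_right 0)"
  shows "has_order f k \<longleftrightarrow> has_order g k"
proof -
  have "((\<lambda>\<epsilon>. f \<epsilon> / \<epsilon> powr k) \<longlongrightarrow> c) (at_right 0) \<longleftrightarrow> ((\<lambda>\<epsilon>. g \<epsilon> / \<epsilon> powr k) \<longlongrightarrow> c) (at_right 0)" for c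
    using assms by (intro tendsto_cong) (auto elim: eventually_mono)
  then show ?thesis by (simp add: has_order_def)
qed

lemma has_order_imp_pos:
  assumes "has_order f k"
  shows "eventually (\<lambda>\<epsilon>. 0 < f \<epsilon>) (at_right 0)"
proof -
  obtain c where "c > 0" "((\<lambda>\<epsilon>. f \<epsilon> / \<epsilon> powr k) \<longlongrightarrow> c) (at_right 0)"
    using assms by (auto simp: has_order_def)
  then have "eventually (\<lambda>\<epsilon>. 0 < f \<epsilon> / \<epsilon> powr k) (at_right 0)" by (rule order_tendstoD(1)[rotated])
  with eventually_pos show ?thesis by eventually_elim (simp add: zero_less_divide_iff)
qed

lemma tendsto_powr_at_right_0:
  assumes "(0::real) \<le> a"
  shows "((\<lambda>\<epsilon>. \<epsilon> powr a) \<longlongrightarrow> (if a = 0 then 1 else 0)) (at_right 0)"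
proof (cases "a = 0")
  case True
  have "eventually (\<lambda>\<epsilon>::real. \<epsilon> powr a = 1) (at_right 0)"
    using eventually_pos by eventually_elim (simp add: True)
  then show ?thesis using True by (simp add: tendsto_eventually)
next
  case False
  have "((\<lambda>\<epsilon>. \<epsilon> powr a) \<longlongrightarrow> 0 powr a) (at_right 0)"
    using assms False by (intro tendsto_powr2 tendsto_intros) (auto simp: eventually_at_right_less
      intro: eventually_mono[OF eventually_pos])
  then show ?thesis using False by simp
qed

text \<open>Positive leading coefficients cannot cancel, so the smaller exponent wins; on a tie the
  coefficients add up.\<close>

lemma has_order_add:
  assumes "has_order f k" "has_order g l"
  shows "has_order (\<lambda>\<epsilon>. f \<epsilon> + g \<epsilon>) (min k l)"
proof -
  obtain c d where c: "c > 0" "((\<lambda>\<epsilon>. f \<epsilon> / \<epsilon> powr k) \<longlongrightarrow> c) (at_right 0)"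
    and d: "d > 0" "((\<lambda>\<epsilon>. g \<epsilon> / \<epsilon> powr l) \<longlongrightarrow> d) (at_right 0)"
    using assms by (auto simp: has_order_def)
  define m where "m = min k l"
  let ?i = "\<lambda>a. if a = (0::real) then 1 else (0::real)"
  have "((\<lambda>\<epsilon>. f \<epsilon> / \<epsilon> powr k * \<epsilon> powr (k - m) + g \<epsilon> / \<epsilon> powr l * \<epsilon> powr (l - m))
      \<longlongrightarrow> c * ?i (k - m) + d * ?i (l - m)) (at_right 0)"
    by (intro tendsto_intros c d tendsto_powr_at_right_0) (auto simp: m_def)
  moreover have "eventually (\<lambda>\<epsilon>. f \<epsilon> / \<epsilon> powr k * \<epsilon> powr (k - m) + g \<epsilon> / \<epsilon> powr l * \<epsilon> powr (l - m)
      = (f \<epsilon> + g \<epsilon>) / \<epsilon> powr m) (at_right 0)"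
    using eventually_pos by eventually_elim (simp add: powr_diff add_divide_distrib)
  ultimately have "((\<lambda>\<epsilon>. (f \<epsilon> + g \<epsilon>) / \<epsilon> powr m) \<longlongrightarrow> c * ?i (k - m) + d * ?i (l - m)) (at_right 0)"
    by (rule Lim_transform_eventually)
  moreover have "0 < c * ?i (k - m) + d * ?i (l - m)"
    using c(1) d(1) by (auto simp: m_def)
  ultimately show ?thesis unfolding has_order_def m_def[symmetric] by blast
qed

lemma has_order_mult:
  assumes "has_order f k" "has_order g l"
  shows "has_order (\<lambda>\<epsilon>. f \<epsilon> * g \<epsilon>) (k + l)"
proof -
  obtain c d where c: "c > 0" "((\<lambda>\<epsilon>. f \<epsilon> / \<epsilon> powr k) \<longlongrightarrow> c) (at_right 0)"
    and d: "d > 0" "((\<lambda>\<epsilon>. g \<epsilon> / \<epsilon> powr l) \<longlongrightarrow> d) (at_right 0)"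
    using assms by (auto simp: has_order_def)
  have "((\<lambda>\<epsilon>. (f \<epsilon> * g \<epsilon>) / \<epsilon> powr (k + l)) \<longlongrightarrow> c * d) (at_right 0)"
    using tendsto_mult[OF c(2) d(2)] by (simp add: powr_add)
  then show ?thesis using c(1) d(1) unfolding has_order_def by (intro exI[of _ "c * d"]) simp
qed

lemma has_order_inverse:
  assumes "has_order f k"
  shows "has_order (\<lambda>\<epsilon>. inverse (f \<epsilon>)) (- k)"
proof -
  obtain c where c: "c > 0" "((\<lambda>\<epsilon>. f \<epsilon> / \<epsilon> powr k) \<longlongrightarrow> c) (at_right 0)"
    using assms by (auto simp: has_order_def)
  have "((\<lambda>\<epsilon>. inverse (f \<epsilon>) / \<epsilon> powr (- k)) \<longlongrightarrow> inverse c) (at_right 0)"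
    using tendsto_inverse[OF c(2)] c(1) by (simp add: powr_minus field_simps)
  then show ?thesis using c(1) unfolding has_order_def by (intro exI[of _ "inverse c"]) simp
qed

lemma has_order_divide:
  assumes "has_order f k" "has_order g l"
  shows "has_order (\<lambda>\<epsilon>. f \<epsilon> / g \<epsilon>) (k - l)"
  using has_order_mult[OF assms(1) has_order_inverse[OF assms(2)]] by (simp add: divide_inverse)

lemma has_order_powr: "has_order (\<lambda>\<epsilon>. \<epsilon> powr k) k"
proof -
  have "((\<lambda>\<epsilon>. \<epsilon> powr k / \<epsilon> powr k) \<longlongrightarrow> 1) (at_right 0)"
    by (rule tendsto_eventually) (use eventually_pos in eventually_elim, simp)
  then show ?thesis unfolding has_order_def by (intro exI[of _ 1]) simp
qed

lemma has_order_sum: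
  assumes "finite I" "I \<noteq> {}" "\<And>i. i \<in> I \<Longrightarrow> has_order (\<lambda>\<epsilon>. f \<epsilon> i) (k i)"
  shows "has_order (\<lambda>\<epsilon>. \<Sum>i\<in>I. f \<epsilon> i) (Min (k ` I))"
  using assms
proof (induction I rule: finite_ne_induct)
  case (insert i I)
  then show ?case using has_order_add[of "\<lambda>\<epsilon>. f \<epsilon> i" "k i" "\<lambda>\<epsilon>. \<Sum>i\<in>I. f \<epsilon> i"]
    by simp
qed simp

lemma has_order_tendsto:
  assumes "has_order f k" "0 \<le> k"
  shows "\<exists>c\<ge>0. (f \<longlongrightarrow> c) (at_right 0) \<and> (0 < c \<longleftrightarrow> k = 0)"
proof -
  obtain c where c: "c > 0" "((\<lambda>\<epsilon>. f \<epsilon> / \<epsilon> powr k) \<longlongrightarrow> c) (at_right 0)"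
    using assms by (auto simp: has_order_def)
  have "((\<lambda>\<epsilon>. f \<epsilon> / \<epsilon> powr k * \<epsilon> powr k) \<longlongrightarrow> c * (if k = 0 then 1 else 0)) (at_right 0)"
    by (intro tendsto_mult c tendsto_powr_at_right_0 assms)
  moreover have "eventually (\<lambda>\<epsilon>. f \<epsilon> / \<epsilon> powr k * \<epsilon> powr k = f \<epsilon>) (at_right 0)"
    using eventually_pos by eventually_elim simp
  ultimately have "(f \<longlongrightarrow> c * (if k = 0 then 1 else 0)) (at_right 0)"
    by (rule Lim_transform_eventually)
  then show ?thesis using c(1) by (intro exI[of _ "c * (if k = 0 then 1 else 0)"]) auto
qed

text \<open>Symmetry of \<open>b\<close> is inherited by the orders after elimination. It also makes
  the orders into the removed state equal to those out of it, so that its weight is comparable with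
  the others.\<close>

lemma balanced_has_order:
  assumes "finite S" "S \<noteq> {}"
    and "\<And>x y. x \<in> S \<Longrightarrow> y \<in> S \<Longrightarrow> has_order (\<lambda>\<epsilon>. K \<epsilon> x y) (b x y)"
    and "\<And>x y. x \<in> S \<Longrightarrow> y \<in> S \<Longrightarrow> b x y = b y x"
    and "eventually (\<lambda>\<epsilon>. balanced S (K \<epsilon>) (p \<epsilon>) \<and> (\<forall>x\<in>S. 0 < p \<epsilon> x)) (at_right 0)"
    and "x \<in> S" "y \<in> S"
  shows "has_order (\<lambda>\<epsilon>. p \<epsilon> x / p \<epsilon> y) 0"
  using assms
proof (induction S arbitrary: K b x y rule: finite_ne_induct)
  case (singleton s)
  have "eventually (\<lambda>\<epsilon>. \<epsilon> powr 0 = p \<epsilon> s / p \<epsilon> s) (at_right 0)"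
    using singleton(3) eventually_pos by eventually_elim auto
  then show ?case using has_order_powr[of 0] has_order_cong singleton by auto
next
  case (insert s T)
  define d where "d \<epsilon> = (\<Sum>z\<in>T. K \<epsilon> s z)" for \<epsilon>
  define m where "m = Min (b s ` T)"
  have d: "has_order d m" unfolding d_def m_def
    using insert.prems(1) insert.hyps by (intro has_order_sum) auto
  have ev: "eventually (\<lambda>\<epsilon>. balanced T (eliminate s T (K \<epsilon>)) (p \<epsilon>) \<and>
      p \<epsilon> s = (\<Sum>x\<in>T. p \<epsilon> x * K \<epsilon> x s) / d \<epsilon> \<and> (\<forall>x\<in>insert s T. 0 < p \<epsilon> x)) (at_right 0)"
    using insert.prems(3) has_order_imp_pos[OF d]
  proof eventually_elim
    case (elim \<epsilon>)
    then show ?case using balanced_insert_iff[of T s "K \<epsilon>" "p \<epsilon>"] insert.hyps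
      unfolding d_def by auto
  qed
  have T: "has_order (\<lambda>\<epsilon>. p \<epsilon> x / p \<epsilon> y) 0" if "x \<in> T" "y \<in> T" for x y
  \<comment> \<open>The orders after elimination compare the direct transition with the detour
    through \<open>s\<close>, where \<open>m\<close> is the order of the exit sum.\<close>
  proof (rule insert.IH[where b = "\<lambda>x y. min (b x y) (b x s + b s y - m)"])
    fix x y assume "x \<in> T" "y \<in> T"
    then show "has_order (\<lambda>\<epsilon>. eliminate s T (K \<epsilon>) x y) (min (b x y) (b x s + b s y - m))"
      unfolding eliminate_def d_def[symmetric] using insert.prems(1)
      by (intro has_order_add has_order_divide has_order_mult d) auto
    show "min (b x y) (b x s + b s y - m) = min (b y x) (b y s + b s x - m)"
      using insert.prems(2)[of x y] insert.prems(2)[of s x] insert.prems(2)[of s y] \<open>x \<in> T\<close> \<open>y \<in> T\<close>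
      by simp
  qed (use that ev in \<open>auto elim: eventually_mono\<close>)
  have s: "has_order (\<lambda>\<epsilon>. p \<epsilon> s / p \<epsilon> y) 0" if y: "y \<in> T" for y
  proof -
    have "has_order (\<lambda>\<epsilon>. (\<Sum>x\<in>T. (p \<epsilon> x / p \<epsilon> y) * K \<epsilon> x s) / d \<epsilon>) (Min ((\<lambda>x. 0 + b x s) ` T) - m)"
      using insert.prems(1) insert.hyps T y
      by (intro has_order_divide has_order_sum has_order_mult d) auto
    \<comment> \<open>By symmetry the minimal order into \<open>s\<close> is \<open>m\<close>, which
      cancels against the order of \<open>d\<close>.\<close>
    moreover have "(\<lambda>x. 0 + b x s) ` T = b s ` T"
      using insert.prems(2)[of s] by (intro image_cong) auto
    moreover have "eventually (\<lambda>\<epsilon>. (\<Sum>x\<in>T. (p \<epsilon> x / p \<epsilon> y) * K \<epsilon> x s) / d \<epsilon> = p \<epsilon> s / p \<epsilon> y) (at_right 0)"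
      using ev by eventually_elim (simp add: sum_divide_distrib mult_ac)
    ultimately show ?thesis using has_order_cong by (fastforce simp: m_def)
  qed
  have "has_order (\<lambda>\<epsilon>. p \<epsilon> s / p \<epsilon> s) 0"
  proof -
    have "eventually (\<lambda>\<epsilon>. \<epsilon> powr 0 = p \<epsilon> s / p \<epsilon> s) (at_right 0)"
      using ev eventually_pos by eventually_elim auto
    then show ?thesis using has_order_powr[of 0] has_order_cong by auto
  qed
  moreover have "has_order (\<lambda>\<epsilon>. p \<epsilon> x / p \<epsilon> s) 0" if "x \<in> T" for x
    using has_order_inverse[OF s[OF that]] by simp
  ultimately show ?case using insert.prems(4,5) T s by auto
qed

subsection \<open>Stationary distributions of finite chains\<close>

lemma pmf_bind_sum:
  assumes "finite A" "set_pmf M \<subseteq> A"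
  shows "pmf (bind_pmf M f) y = (\<Sum>a\<in>A. pmf M a * pmf (f a) y)"
  unfolding pmf_bind using assms by (subst integral_measure_pmf[of A]) auto

primrec steps :: "('s \<Rightarrow> 's pmf) \<Rightarrow> nat \<Rightarrow> 's \<Rightarrow> 's pmf" where
  "steps K 0 = return_pmf"
| "steps K (Suc n) = (\<lambda>x. bind_pmf (K x) (steps K n))"

text \<open>Used to see that \<open>K\<close> maps a stationary distribution of its
  \<open>n\<close>-step kernel to another one.\<close>

lemma steps_commute: "bind_pmf (steps K n x) K = bind_pmf (K x) (steps K n)"
  by (induction n arbitrary: x) (simp_all add: bind_return_pmf bind_return_pmf' bind_assoc_pmf)

lemma set_pmf_steps:
  assumes "\<And>x. x \<in> S \<Longrightarrow> set_pmf (K x) \<subseteq> S" "x \<in> S"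
  shows "set_pmf (steps K n x) \<subseteq> S"
  using assms(2)
proof (induction n arbitrary: x)
  case (Suc n)
  then show ?case using assms(1) by fastforce
qed simp

lemma stationary_steps:
  assumes "stationary S K \<pi>"
  shows "stationary S (steps K n) \<pi>"
proof -
  have K: "bind_pmf \<pi> K = \<pi>" using assms by (simp add: stationary_def)
  have "bind_pmf \<pi> (steps K n) = \<pi>"
  proof (induction n)
    case (Suc n)
    have "bind_pmf \<pi> (steps K (Suc n)) = bind_pmf (bind_pmf \<pi> K) (steps K n)"
      by (simp add: bind_assoc_pmf)
    then show ?case using Suc K by simp
  qed (simp add: bind_return_pmf')
  then show ?thesis using assms by (simp add: stationary_def)
qed

text \<open>A probability kernel that stays in \<open>S\<close> has row sums 1 there, so the outflow
  is the weight itself; outside \<open>S\<close> there is no mass before or after the step.\<close>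

lemma stationary_iff_balanced:
  assumes S: "finite S" "\<And>x. x \<in> S \<Longrightarrow> set_pmf (K x) \<subseteq> S"
  shows "stationary S K \<pi> \<longleftrightarrow> set_pmf \<pi> \<subseteq> S \<and> balanced S (\<lambda>x. pmf (K x)) (pmf \<pi>)"
proof (cases "set_pmf \<pi> \<subseteq> S")
  case True
  have row: "(\<Sum>z\<in>S. pmf (K y) z) = 1" if "y \<in> S" for y
    using S that by (intro sum_pmf_eq_1) auto
  have out: "pmf (bind_pmf \<pi> K) y = pmf \<pi> y" if "y \<notin> S" for y
  proof -
    have "y \<notin> set_pmf (bind_pmf \<pi> K)" "y \<notin> set_pmf \<pi>" using that True S by auto
    then show ?thesis by (simp add: set_pmf_iff del: set_bind_pmf)
  qed
  have "bind_pmf \<pi> K = \<pi> \<longleftrightarrow> (\<forall>y. pmf (bind_pmf \<pi> K) y = pmf \<pi> y)"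
    by (auto intro: pmf_eqI)
  also have "\<dots> \<longleftrightarrow> (\<forall>y\<in>S. pmf (bind_pmf \<pi> K) y = pmf \<pi> y)" using out by auto
  also have "\<dots> \<longleftrightarrow> balanced S (\<lambda>x. pmf (K x)) (pmf \<pi>)"
    unfolding balanced_def by (auto simp: row pmf_bind_sum[OF S(1) True])
  finally show ?thesis using True by (simp add: stationary_def)
qed (simp add: stationary_def)

text \<open>Positivity is asked only of an \<open>n\<close>-step kernel, whose stationary
  distribution is unique by elimination. As this kernel commutes with \<open>K\<close>, one step of
  \<open>K\<close> maps that distribution to a stationary one, hence to itself.\<close>

lemma stationary_ex_unique:
  assumes S: "finite S" "S \<noteq> {}" and K: "\<And>x. x \<in> S \<Longrightarrow> set_pmf (K x) \<subseteq> S"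
    and pos: "\<And>x y. x \<in> S \<Longrightarrow> y \<in> S \<Longrightarrow> 0 < pmf (steps K n x) y"
  shows "\<exists>\<pi>. (\<forall>\<rho>. stationary S K \<rho> \<longleftrightarrow> \<rho> = \<pi>) \<and> (\<forall>x\<in>S. 0 < pmf \<pi> x)"
proof -
  let ?Q = "steps K n"
  have Q: "set_pmf (?Q x) \<subseteq> S" if "x \<in> S" for x using set_pmf_steps[of S K] K that by blast
  obtain p where p: "balanced S (\<lambda>x. pmf (?Q x)) p" and p0: "\<And>x. x \<in> S \<Longrightarrow> 0 < p x"
    and u: "\<And>q x y. balanced S (\<lambda>x. pmf (?Q x)) q \<Longrightarrow> x \<in> S \<Longrightarrow> y \<in> S \<Longrightarrow> q x * p y = q y * p x"
    using balanced_ex_unique_upto_scaling[OF S, of "\<lambda>x. pmf (?Q x)"] pos by blast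
  define P where "P = (\<Sum>x\<in>S. p x)"
  have P: "P > 0" unfolding P_def using S p0 by (intro sum_pos) auto
  define f where "f x = (if x \<in> S then p x / P else 0)" for x
  define \<pi> where "\<pi> = embed_pmf f"
  have f0: "0 \<le> f x" for x using p0 P by (auto simp: f_def intro: less_imp_le)
  have "(\<integral>\<^sup>+x. f x \<partial>count_space UNIV) = (\<Sum>x\<in>S. ennreal (f x))"
    using S by (intro nn_integral_count_space'[of S]) (auto simp: f_def)
  also have "\<dots> = ennreal (\<Sum>x\<in>S. f x)" using f0 by simp
  also have "(\<Sum>x\<in>S. f x) = 1"
    using P by (simp add: f_def P_def[symmetric] sum_divide_distrib[symmetric] cong: sum.cong)
  finally have pmf\<pi>: "pmf \<pi> x = f x" for x unfolding \<pi>_def using f0 by (intro pmf_embed_pmf) auto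
  have uQ: "\<rho> = \<pi>" if \<rho>: "stationary S ?Q \<rho>" for \<rho>
  proof (rule pmf_eqI)
    fix x
    have sub: "set_pmf \<rho> \<subseteq> S" using \<rho> by (simp add: stationary_def)
    show "pmf \<rho> x = pmf \<pi> x"
    proof (cases "x \<in> S")
      case True
      \<comment> \<open>Summing the proportionality over \<open>y\<close> and using that
        \<open>\<rho>\<close> has total mass 1 identifies it with the normalised
        \<open>p\<close>.\<close>
      have "pmf \<rho> x * P = (\<Sum>y\<in>S. pmf \<rho> x * p y)" by (simp add: P_def sum_distrib_left)
      also have "\<dots> = (\<Sum>y\<in>S. pmf \<rho> y * p x)"
        using \<rho> True stationary_iff_balanced[OF S(1) Q] u by (intro sum.cong) auto
      also have "\<dots> = p x" using sum_pmf_eq_1[OF S(1) sub] by (simp add: sum_distrib_right[symmetric])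
      finally show ?thesis using P True by (simp add: pmf\<pi> f_def field_simps)
    next
      case False
      then have "x \<notin> set_pmf \<rho>" using sub by auto
      then show ?thesis using False by (simp add: pmf\<pi> f_def set_pmf_iff)
    qed
  qed
  have "balanced S (\<lambda>x. pmf (?Q x)) (pmf \<pi>)"
    using p unfolding balanced_def pmf\<pi> f_def
    by (simp add: sum_divide_distrib[symmetric] cong: sum.cong)
  moreover have sub: "set_pmf \<pi> \<subseteq> S" by (auto simp: set_pmf_iff pmf\<pi> f_def split: if_splits)
  ultimately have sQ: "stationary S ?Q \<pi>" using stationary_iff_balanced[OF S(1) Q] by simp
  have "bind_pmf (bind_pmf \<pi> K) ?Q = bind_pmf (bind_pmf \<pi> ?Q) K"
    by (simp add: bind_assoc_pmf steps_commute)
  then have "stationary S ?Q (bind_pmf \<pi> K)"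
    using sQ sub K by (auto simp: stationary_def)
  then have "stationary S K \<pi>" using uQ sub by (simp add: stationary_def)
  moreover have "\<rho> = \<pi>" if "stationary S K \<rho>" for \<rho> using uQ stationary_steps[OF that] .
  moreover have "\<forall>x\<in>S. 0 < pmf \<pi> x" using p0 P by (simp add: pmf\<pi> f_def)
  ultimately show ?thesis by blast
qed

subsection \<open>Resistances\<close>

text \<open>The coefficient may be \<open>0\<close>, so this only bounds the order of \<open>f\<close> from below by \<open>k\<close>.\<close>

definition leading :: "(real \<Rightarrow> real) \<Rightarrow> nat \<Rightarrow> real \<Rightarrow> bool" where
  "leading f k c \<longleftrightarrow> 0 \<le> c \<and> ((\<lambda>\<epsilon>. f \<epsilon> / \<epsilon> ^ k) \<longlongrightarrow> c) (at_right 0)"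

text \<open>The target exponent \<open>k\<close> may be smaller than \<open>a + b\<close>; the
  product then vanishes at order \<open>k\<close>. This handles detours that cost more than the
  resistance.\<close>

lemma leading_mult:
  assumes f: "leading f a c" and g: "leading g b d" and le: "k \<le> a + b"
  shows "leading (\<lambda>\<epsilon>. f \<epsilon> * g \<epsilon>) k (if k = a + b then c * d else 0)"
proof -
  \<comment> \<open>Since \<open>0 ^ 0 = 1\<close>, this single limit covers both cases.\<close>
  have "((\<lambda>\<epsilon>::real. \<epsilon> ^ (a + b - k)) \<longlongrightarrow> 0 ^ (a + b - k)) (at_right 0)"
    by (intro tendsto_intros)
  then have "((\<lambda>\<epsilon>. f \<epsilon> / \<epsilon> ^ a * (g \<epsilon> / \<epsilon> ^ b) * \<epsilon> ^ (a + b - k))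
      \<longlongrightarrow> c * d * 0 ^ (a + b - k)) (at_right 0)"
    using f g unfolding leading_def by (intro tendsto_mult) auto
  moreover have "eventually (\<lambda>\<epsilon>. f \<epsilon> / \<epsilon> ^ a * (g \<epsilon> / \<epsilon> ^ b) * \<epsilon> ^ (a + b - k)
      = f \<epsilon> * g \<epsilon> / \<epsilon> ^ k) (at_right 0)"
    using eventually_pos
  proof eventually_elim
    case (elim \<epsilon>)
    have "\<epsilon> ^ (a + b - k) = \<epsilon> ^ a * \<epsilon> ^ b / \<epsilon> ^ k"
      using elim le by (simp add: power_diff power_add)
    then show ?case using elim by simp
  qed
  ultimately have "((\<lambda>\<epsilon>. f \<epsilon> * g \<epsilon> / \<epsilon> ^ k) \<longlongrightarrow> c * d * 0 ^ (a + b - k)) (at_right 0)"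
    by (rule Lim_transform_eventually)
  moreover have "c * d * 0 ^ (a + b - k) = (if k = a + b then c * d else 0)"
    using le by simp
  moreover have "0 \<le> c" "0 \<le> d" using f g by (auto simp: leading_def)
  ultimately show ?thesis by (simp add: leading_def)
qed

lemma leading_cong:
  assumes "eventually (\<lambda>\<epsilon>. f \<epsilon> = g \<epsilon>) (at_right 0)"
  shows "leading f k c \<longleftrightarrow> leading g k c"
proof -
  have "((\<lambda>\<epsilon>. f \<epsilon> / \<epsilon> ^ k) \<longlongrightarrow> c) (at_right 0) \<longleftrightarrow> ((\<lambda>\<epsilon>. g \<epsilon> / \<epsilon> ^ k) \<longlongrightarrow> c) (at_right 0)"
    using assms by (intro tendsto_cong) (auto elim: eventually_mono)
  then show ?thesis by (simp add: leading_def)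
qed

lemma leading_sum:
  assumes "\<And>i. i \<in> I \<Longrightarrow> leading (f i) k (c i)"
  shows "leading (\<lambda>\<epsilon>. \<Sum>i\<in>I. f i \<epsilon>) k (\<Sum>i\<in>I. c i)"
  using assms by (auto simp: leading_def sum_divide_distrib intro!: tendsto_sum sum_nonneg)

lemma leading_const: "0 \<le> c \<Longrightarrow> leading (\<lambda>_. c) 0 c"
  by (simp add: leading_def)

lemma leading_zero: "leading (\<lambda>_. 0) k 0"
  by (simp add: leading_def)

lemma leading_error_prob:
  "leading (\<lambda>\<epsilon>. \<epsilon> ^ k * (1 - \<epsilon>) ^ m) k 1"
proof -
  have "((\<lambda>\<epsilon>::real. (1 - \<epsilon>) ^ m) \<longlongrightarrow> (1 - 0) ^ m) (at_right 0)"
    by (intro tendsto_intros)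
  moreover have "eventually (\<lambda>\<epsilon>::real. (1 - \<epsilon>) ^ m = \<epsilon> ^ k * (1 - \<epsilon>) ^ m / \<epsilon> ^ k) (at_right 0)"
    using eventually_pos by eventually_elim simp
  ultimately have "((\<lambda>\<epsilon>::real. \<epsilon> ^ k * (1 - \<epsilon>) ^ m / \<epsilon> ^ k) \<longlongrightarrow> (1 - 0) ^ m) (at_right 0)"
    by (rule Lim_transform_eventually)
  then show ?thesis by (simp add: leading_def)
qed

text \<open>The resistance between states \<open>x\<close> and \<open>y\<close> is \<open>card (x - y)\<close>: projects in \<open>x - y\<close> can
  only disappear by errors, whereas new projects may be formed without any error.\<close>

definition resistant :: "'p set set \<Rightarrow> (real \<Rightarrow> 'p set \<Rightarrow> 'p set pmf) \<Rightarrow> bool" where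
  "resistant X K \<longleftrightarrow> (\<forall>x\<in>X. (\<forall>\<epsilon>. set_pmf (K \<epsilon> x) \<subseteq> X) \<and>
     (\<forall>y\<in>X. \<exists>c. leading (\<lambda>\<epsilon>. pmf (K \<epsilon> x) y) (card (x - y)) c))"

text \<open>Sharpness of the bound in \<open>resistant\<close>, kept separate because a single
  period need not attain it for every pair.\<close>

definition cheapest :: "(real \<Rightarrow> 'p set \<Rightarrow> 'p set pmf) \<Rightarrow> 'p set \<Rightarrow> 'p set \<Rightarrow> bool" where
  "cheapest K x y \<longleftrightarrow> (\<exists>c>0. leading (\<lambda>\<epsilon>. pmf (K \<epsilon> x) y) (card (x - y)) c)"

lemma cheapest_has_order:
  assumes "cheapest K x y"
  shows "has_order (\<lambda>\<epsilon>. pmf (K \<epsilon> x) y) (card (x - y))"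
proof -
  obtain c where c: "c > 0" "((\<lambda>\<epsilon>. pmf (K \<epsilon> x) y / \<epsilon> ^ card (x - y)) \<longlongrightarrow> c) (at_right 0)"
    using assms by (auto simp: cheapest_def leading_def)
  have "eventually (\<lambda>\<epsilon>. pmf (K \<epsilon> x) y / \<epsilon> ^ card (x - y) = pmf (K \<epsilon> x) y / \<epsilon> powr card (x - y)) (at_right 0)"
    using eventually_pos by eventually_elim (simp add: powr_realpow)
  with c(2) have "((\<lambda>\<epsilon>. pmf (K \<epsilon> x) y / \<epsilon> powr card (x - y)) \<longlongrightarrow> c) (at_right 0)"
    by (rule Lim_transform_eventually)
  then show ?thesis using c(1) unfolding has_order_def by blast
qed

section \<open>Resistances under composition of kernels\<close>

context
  fixes X :: "'p set set" and A B :: "real \<Rightarrow> 'p set \<Rightarrow> 'p set pmf"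
  assumes fin: "finite X" "\<And>x. x \<in> X \<Longrightarrow> finite x"
    and A: "resistant X A" and B: "resistant X B"
begin

text \<open>Summing over the intermediate state \<open>z\<close>, the inclusion of
  \<open>x - y\<close> in \<open>(x - z) \<union> (z - y)\<close> gives a triangle inequality. Only
  states with equality contribute at leading order, and one sharp path suffices because coefficients
  are nonnegative.\<close>

lemma resistant_bind_aux:
  assumes x: "x \<in> X" and y: "y \<in> X"
  shows "\<exists>c. leading (\<lambda>\<epsilon>. pmf (bind_pmf (A \<epsilon> x) (B \<epsilon>)) y) (card (x - y)) c \<and>
    ((\<exists>z\<in>X. cheapest A x z \<and> cheapest B z y \<and> card (x - z) + card (z - y) = card (x - y)) \<longrightarrow> c > 0)"
proof -
  have "\<forall>z\<in>X. \<exists>c. leading (\<lambda>\<epsilon>. pmf (A \<epsilon> x) z) (card (x - z)) c \<and> (cheapest A x z \<longrightarrow> c > 0)"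
    using A x unfolding resistant_def cheapest_def by blast
  then obtain a where a: "\<And>z. z \<in> X \<Longrightarrow> leading (\<lambda>\<epsilon>. pmf (A \<epsilon> x) z) (card (x - z)) (a z)"
    "\<And>z. z \<in> X \<Longrightarrow> cheapest A x z \<Longrightarrow> a z > 0" by metis
  have "\<forall>z\<in>X. \<exists>c. leading (\<lambda>\<epsilon>. pmf (B \<epsilon> z) y) (card (z - y)) c \<and> (cheapest B z y \<longrightarrow> c > 0)"
    using B y unfolding resistant_def cheapest_def by blast
  then obtain b where b: "\<And>z. z \<in> X \<Longrightarrow> leading (\<lambda>\<epsilon>. pmf (B \<epsilon> z) y) (card (z - y)) (b z)"
    "\<And>z. z \<in> X \<Longrightarrow> cheapest B z y \<Longrightarrow> b z > 0" by metis
  define c where "c z = (if card (x - y) = card (x - z) + card (z - y) then a z * b z else 0)" for z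
  have le: "card (x - y) \<le> card (x - z) + card (z - y)" if "z \<in> X" for z
  proof -
    have "card (x - y) \<le> card ((x - z) \<union> (z - y))" using fin x that by (intro card_mono) auto
    also have "\<dots> \<le> card (x - z) + card (z - y)" by (rule card_Un_le)
    finally show ?thesis .
  qed
  have "leading (\<lambda>\<epsilon>. \<Sum>z\<in>X. pmf (A \<epsilon> x) z * pmf (B \<epsilon> z) y) (card (x - y)) (\<Sum>z\<in>X. c z)"
    unfolding c_def by (intro leading_sum leading_mult a b le)
  moreover have "pmf (bind_pmf (A \<epsilon> x) (B \<epsilon>)) y = (\<Sum>z\<in>X. pmf (A \<epsilon> x) z * pmf (B \<epsilon> z) y)" for \<epsilon>
    using A x fin by (intro pmf_bind_sum) (auto simp: resistant_def)
  moreover have "(\<Sum>z\<in>X. c z) > 0"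
    if "z \<in> X" "cheapest A x z" "cheapest B z y" "card (x - z) + card (z - y) = card (x - y)" for z
  proof (rule sum_pos2[OF fin(1) that(1)])
    show "0 < c z" using that a b by (simp add: c_def)
    show "0 \<le> c i" if "i \<in> X" for i using a(1)[OF that] b(1)[OF that] by (simp add: c_def leading_def)
  qed
  ultimately show ?thesis by (intro exI[of _ "\<Sum>z\<in>X. c z"]) auto
qed

lemma resistant_bind: "resistant X (\<lambda>\<epsilon> x. bind_pmf (A \<epsilon> x) (B \<epsilon>))"
  unfolding resistant_def
proof (intro ballI conjI allI)
  fix x \<epsilon> assume "x \<in> X"
  then have "set_pmf (A \<epsilon> x) \<subseteq> X" "\<And>z. z \<in> X \<Longrightarrow> set_pmf (B \<epsilon> z) \<subseteq> X"
    using A B by (auto simp: resistant_def)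
  then show "set_pmf (bind_pmf (A \<epsilon> x) (B \<epsilon>)) \<subseteq> X" by auto
qed (use resistant_bind_aux in blast)

lemma cheapest_bind:
  assumes "x \<in> X" "y \<in> X" "z \<in> X" "cheapest A x z" "cheapest B z y"
    "card (x - z) + card (z - y) = card (x - y)"
  shows "cheapest (\<lambda>\<epsilon> x. bind_pmf (A \<epsilon> x) (B \<epsilon>)) x y"
  using resistant_bind_aux[of x y] assms unfolding cheapest_def[of "\<lambda>\<epsilon> x. bind_pmf (A \<epsilon> x) (B \<epsilon>)"] by blast

end

lemma resistant_return: "resistant X (\<lambda>_. return_pmf)"
  unfolding resistant_def
proof safe
  fix x y assume "x \<in> X" "y \<in> X"
  show "\<exists>c. leading (\<lambda>\<epsilon>. pmf (return_pmf x) y) (card (x - y)) c"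
  proof (cases "x = y")
    case True
    then show ?thesis using leading_const[of 1] by auto
  next
    case False
    then show ?thesis using leading_zero by auto
  qed
qed auto

lemma resistant_steps:
  assumes "finite X" "\<And>x. x \<in> X \<Longrightarrow> finite x" "resistant X K"
  shows "resistant X (\<lambda>\<epsilon>. steps (K \<epsilon>) n)"
proof (induction n)
  case (Suc n)
  then show ?case using resistant_bind[OF assms Suc] by simp
qed (simp add: resistant_return)

section \<open>Probabilities of error sets and their orders\<close>

lemma pmf_error_set:
  assumes S: "finite S" "E \<subseteq> S" and \<epsilon>: "0 < \<epsilon>" "\<epsilon> < 1"
  shows "pmf (error_set S \<epsilon>) E = \<epsilon> ^ card E * (1 - \<epsilon>) ^ (card S - card E)"
proof -
  let ?M = "Pi_pmf S False (\<lambda>_. bernoulli_pmf \<epsilon>)" and ?h = "\<lambda>p. p \<in> E"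
  let ?f = "\<lambda>h. {p \<in> S. h p}"
  have set: "set_pmf ?M = {h. \<forall>p. h p \<longrightarrow> p \<in> S}"
    using \<epsilon> S by (auto simp: set_Pi_pmf PiE_dflt_def set_pmf_bernoulli)
  \<comment> \<open>On the support \<open>h\<close> is \<open>False\<close> outside
    \<open>S\<close>, the default of \<open>Pi_pmf\<close>, so the set of hit projects determines
    \<open>h\<close>.\<close>
  have inj: "inj_on ?f (set_pmf ?M)" unfolding set by (auto simp: inj_on_def fun_eq_iff)
  have E: "E = ?f ?h" using S by auto
  have h: "?h \<in> set_pmf ?M" unfolding set using S by auto
  have "pmf (error_set S \<epsilon>) E = pmf (map_pmf ?f ?M) (?f ?h)"
    using E by (simp add: error_set_def)
  also have "\<dots> = pmf ?M ?h" by (rule pmf_map_inj[OF inj h])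
  also have "\<dots> = (\<Prod>p\<in>S. pmf (bernoulli_pmf \<epsilon>) (?h p))"
    using S by (intro pmf_Pi') auto
  also have "\<dots> = (\<Prod>p\<in>S. if p \<in> E then \<epsilon> else 1 - \<epsilon>)"
    using \<epsilon> by (intro prod.cong) auto
  also have "\<dots> = (\<Prod>p\<in>S \<inter> E. \<epsilon>) * (\<Prod>p\<in>S - E. 1 - \<epsilon>)"
    using S by (simp add: prod.If_cases Diff_eq)
  also have "\<dots> = \<epsilon> ^ card E * (1 - \<epsilon>) ^ (card S - card E)"
    using S by (simp add: Int_absorb1 card_Diff_subset finite_subset)
  finally show ?thesis .
qed

lemma set_error_set: "finite S \<Longrightarrow> E \<in> set_pmf (error_set S \<epsilon>) \<Longrightarrow> E \<subseteq> S"
  by (auto simp: error_set_def)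

lemma leading_error_set:
  assumes "finite S" "E \<subseteq> S"
  shows "leading (\<lambda>\<epsilon>. pmf (error_set S \<epsilon>) E) (card E) 1"
proof -
  have "eventually (\<lambda>\<epsilon>::real. \<epsilon> < 1) (at_right 0)" by (intro eventually_at_rightI[of 0 1]) auto
  with eventually_pos have "eventually (\<lambda>\<epsilon>. pmf (error_set S \<epsilon>) E
      = \<epsilon> ^ card E * (1 - \<epsilon>) ^ (card S - card E)) (at_right 0)"
    by eventually_elim (rule pmf_error_set[OF assms])
  then show ?thesis using leading_error_prob by (subst leading_cong)
qed

text \<open>Conditions on the error set, with \<open>R E\<close> the outcome law when
  \<open>E\<close> is hit. If every outcome \<open>z\<close> needs at least
  \<open>card (x - z)\<close> errors, the bound follows, and an error set of exactly that size makes
  it sharp.\<close>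

lemma leading_error_bind:
  assumes S: "finite S"
    and cost: "\<And>E z. E \<subseteq> S \<Longrightarrow> z \<in> set_pmf (R E) \<Longrightarrow> card (x - z) \<le> card E"
  shows "\<exists>c. leading (\<lambda>\<epsilon>. pmf (bind_pmf (error_set S \<epsilon>) R) z) (card (x - z)) c \<and>
    ((\<exists>E\<subseteq>S. z \<in> set_pmf (R E) \<and> card E = card (x - z)) \<longrightarrow> c > 0)"
proof -
  \<comment> \<open>The outcome law does not depend on \<open>\<epsilon>\<close> and is treated as
    having order 0; the sum \<open>card E + 0\<close> matches the form in
    \<open>leading_mult\<close>.\<close>
  define c where "c E = (if card (x - z) = card E + 0 then 1 * pmf (R E) z else 0)" for E
  have "leading (\<lambda>\<epsilon>. pmf (error_set S \<epsilon>) E * pmf (R E) z) (card (x - z)) (c E)"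
    if "E \<in> Pow S" for E
  proof (cases "z \<in> set_pmf (R E)")
    case True
    then show ?thesis unfolding c_def using S that cost
      by (intro leading_mult leading_error_set leading_const) auto
  next
    case False
    then have "pmf (R E) z = 0" by (simp add: set_pmf_iff)
    then show ?thesis using leading_zero by (simp add: c_def)
  qed
  then have "leading (\<lambda>\<epsilon>. \<Sum>E\<in>Pow S. pmf (error_set S \<epsilon>) E * pmf (R E) z) (card (x - z))
      (\<Sum>E\<in>Pow S. c E)"
    by (rule leading_sum)
  moreover have "pmf (bind_pmf (error_set S \<epsilon>) R) z
      = (\<Sum>E\<in>Pow S. pmf (error_set S \<epsilon>) E * pmf (R E) z)" for \<epsilon>
    using S set_error_set[OF S] by (intro pmf_bind_sum) auto
  moreover have "(\<Sum>E\<in>Pow S. c E) > 0"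
    if "E \<subseteq> S" "z \<in> set_pmf (R E)" "card E = card (x - z)" for E
  proof (rule sum_pos2)
    show "0 < c E" using that by (simp add: c_def pmf_positive)
  qed (use S that in \<open>auto simp: c_def\<close>)
  ultimately show ?thesis by (intro exI[of _ "\<Sum>E\<in>Pow S. c E"]) auto
qed

subsection \<open>Perturbed team-wise dynamics\<close>

text \<open>The dynamics is analysed from these properties alone; teams and endowments enter only
  when they are verified for the model.\<close>

locale independence_system =
  fixes P :: "'p set" and X :: "'p set set"
  assumes finite_P: "finite P" and P_nonempty: "P \<noteq> {}"
    and subset_P: "x \<in> X \<Longrightarrow> x \<subseteq> P"
    and down_closed: "x \<in> X \<Longrightarrow> y \<subseteq> x \<Longrightarrow> y \<in> X"
    and singleton_in: "p \<in> P \<Longrightarrow> {p} \<in> X"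
begin

lemma finite_X: "finite X"
  using finite_P subset_P by (meson Pow_iff finite_Pow_iff finite_subset subsetI)

lemma finite_state: "x \<in> X \<Longrightarrow> finite x"
  using finite_P subset_P finite_subset by blast

text \<open>Errors \<open>E\<close> lead to \<open>x - E\<close>, so reaching \<open>z\<close>
  requires hitting \<open>x - z\<close>, and hitting exactly this set suffices when \<open>z\<close>
  is a subset of \<open>x\<close>.\<close>

lemma destructive_resistant:
  shows "resistant X destructive_scheme"
    and "x \<in> X \<Longrightarrow> z \<subseteq> x \<Longrightarrow> cheapest destructive_scheme x z"
proof -
  have eq: "destructive_scheme \<epsilon> x = bind_pmf (error_set x \<epsilon>) (\<lambda>E. return_pmf (x - E))" for \<epsilon> and x :: "'p set"
    by (simp add: destructive_scheme_def map_pmf_def)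
  have lead: "\<exists>c. leading (\<lambda>\<epsilon>. pmf (destructive_scheme \<epsilon> x) z) (card (x - z)) c \<and>
    ((\<exists>E\<subseteq>x. z \<in> set_pmf (return_pmf (x - E)) \<and> card E = card (x - z)) \<longrightarrow> c > 0)"
    if "x \<in> X" for x z
    unfolding eq using finite_state[OF that]
    by (intro leading_error_bind) (auto simp: double_diff intro!: card_mono finite_subset)
  show "resistant X destructive_scheme"
    unfolding resistant_def
  proof (intro ballI conjI allI)
    show "set_pmf (destructive_scheme \<epsilon> x) \<subseteq> X" if "x \<in> X" for \<epsilon> x
      using that down_closed by (auto simp: destructive_scheme_def)
  qed (use lead in blast)
  show "cheapest destructive_scheme x z" if "x \<in> X" "z \<subseteq> x"
  proof -
    have "\<exists>E\<subseteq>x. z \<in> set_pmf (return_pmf (x - E)) \<and> card E = card (x - z)"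
      using that(2) by (intro exI[of _ "x - z"]) auto
    then show ?thesis using lead[OF that(1), of z] unfolding cheapest_def by blast
  qed
qed

text \<open>Constructive errors remove nothing, so every project of \<open>x - z\<close> must still
  be hit. For \<open>z\<close> inside \<open>x\<close>, hitting exactly \<open>x - z\<close> touches
  existing projects only, so no conflict arises and \<open>res\<close> is forced to return
  \<open>z\<close>.\<close>

lemma uniform_resistant:
  assumes res: "error_outcome P X res"
  shows "resistant X (uniform_scheme P res)"
    and "x \<in> X \<Longrightarrow> z \<subseteq> x \<Longrightarrow> cheapest (uniform_scheme P res) x z"
proof -
  have lead: "\<exists>c. leading (\<lambda>\<epsilon>. pmf (uniform_scheme P res \<epsilon> x) z) (card (x - z)) c \<and>
    ((\<exists>E\<subseteq>P. z \<in> set_pmf (res x E) \<and> card E = card (x - z)) \<longrightarrow> c > 0)"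
    if x: "x \<in> X" for x z
    unfolding uniform_scheme_def
  proof (rule leading_error_bind[OF finite_P])
    fix E z assume E: "E \<subseteq> P" and z: "z \<in> set_pmf (res x E)"
    have "\<exists>F\<subseteq>formed_by_error X x E. z = (x - E) \<union> F"
      using res x E z unfolding error_outcome_def by blast
    then have "x - z \<subseteq> E" by auto
    then show "card (x - z) \<le> card E" using E finite_P by (meson card_mono finite_subset)
  qed
  show "resistant X (uniform_scheme P res)"
    unfolding resistant_def
  proof (intro ballI conjI allI)
    fix x \<epsilon> assume "x \<in> X"
    then show "set_pmf (uniform_scheme P res \<epsilon> x) \<subseteq> X"
      using res set_error_set[OF finite_P] unfolding uniform_scheme_def error_outcome_def by fastforce
  qed (use lead in blast)
  show "cheapest (uniform_scheme P res) x z" if x: "x \<in> X" "z \<subseteq> x"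
  proof -
    have E: "x - z \<subseteq> P" using subset_P x by blast
    have none: "formed_by_error X x (x - z) = {}" by (auto simp: formed_by_error_def)
    have "y = z" if "y \<in> set_pmf (res x (x - z))" for y
    proof -
      have "x - (x - z) \<union> formed_by_error X x (x - z) \<in> X \<longrightarrow>
          y = x - (x - z) \<union> formed_by_error X x (x - z)"
        using res x(1) E that unfolding error_outcome_def by blast
      then show ?thesis using none x down_closed by (simp add: double_diff)
    qed
    then have "z \<in> set_pmf (res x (x - z))"
      using set_pmf_not_empty[of "res x (x - z)"] by blast
    then show ?thesis using lead[OF x(1), of z] E unfolding cheapest_def by blast
  qed
qed

end

text \<open>Both schemes are covered by two properties of \<open>err\<close>: each lost project
  costs an error, and every subset of the current state is reached at exactly that cost.\<close>

locale perturbed_teamwise = independence_system P X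
  for P :: "'p set" and X :: "'p set set" +
  fixes draw :: "'p set \<Rightarrow> 'p pmf" and err :: "real \<Rightarrow> 'p set \<Rightarrow> 'p set pmf"
  assumes draw: "full_support_draw P X draw"
    and err_resistant: "resistant X err"
    and err_cheapest: "x \<in> X \<Longrightarrow> z \<subseteq> x \<Longrightarrow> cheapest err x z"
begin

abbreviation K where "K \<equiv> perturbed_step X draw err"

lemma set_teamwise_step:
  assumes "x \<in> X"
  shows "set_pmf (teamwise_step X draw x) = (\<lambda>p. if x \<union> {p} \<in> X then x \<union> {p} else x) ` P"
  using assms draw by (simp add: teamwise_step_def full_support_draw_def)

text \<open>A team-wise step never removes a project, so reachable states have resistance 0, and
  unreachable ones get coefficient 0 at any order.\<close>

lemma teamwise_resistant: "resistant X (\<lambda>_. teamwise_step X draw)"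
  unfolding resistant_def
proof (intro ballI conjI allI)
  fix x y assume x: "x \<in> X" and y: "y \<in> X"
  show "\<exists>c. leading (\<lambda>\<epsilon>. pmf (teamwise_step X draw x) y) (card (x - y)) c"
  proof (cases "y \<in> set_pmf (teamwise_step X draw x)")
    case True
    then have "x - y = {}" using set_teamwise_step[OF x] by (auto split: if_splits)
    then show ?thesis using leading_const[OF pmf_nonneg] by (metis card.empty)
  next
    case False
    then have "pmf (teamwise_step X draw x) y = 0" by (simp add: set_pmf_iff)
    then show ?thesis using leading_zero by auto
  qed
qed (auto simp: set_teamwise_step)

lemma K_resistant: "resistant X K"
  using resistant_bind[OF finite_X finite_state err_resistant teamwise_resistant]
  by (simp add: perturbed_step_def[abs_def])

text \<open>A step from the empty state always forms the drawn project, and no step removes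
  one.\<close>

lemma K_nonempty:
  assumes "x \<in> X"
  shows "set_pmf (K \<epsilon> x) \<subseteq> X - {{}}"
proof -
  have "set_pmf (teamwise_step X draw z) \<subseteq> X - {{}}" if "z \<in> X" for z
    using that singleton_in by (auto simp: set_teamwise_step)
  moreover have "set_pmf (err \<epsilon> x) \<subseteq> X" using err_resistant assms by (simp add: resistant_def)
  ultimately show ?thesis by (auto simp: perturbed_step_def)
qed

text \<open>Errors first reduce \<open>x\<close> to \<open>x \<inter> y\<close> at the full cost
  \<open>card (x - y)\<close>; the step then adds the missing project for free.\<close>

lemma K_cheapest:
  assumes x: "x \<in> X" and y: "y \<in> X" "y \<noteq> {}" and le: "card (y - x) \<le> 1"
  shows "cheapest K x y"
proof -
  have z: "x \<inter> y \<in> X" by (rule down_closed[OF x]) simp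
  obtain p where p: "p \<in> y" "x \<inter> y \<union> {p} = y"
  proof (cases "y - x = {}")
    case True
    \<comment> \<open>Nothing is missing: redrawing a project already in \<open>y\<close> keeps the
      state, which is where \<open>y\<close> must be nonempty.\<close>
    then show ?thesis using y(2) that by blast
  next
    case False
    then have "card (y - x) = 1" using le finite_state[OF y(1)]
      by (metis One_nat_def Suc_leI card_gt_0_iff finite_Diff le_antisym)
    then obtain p where "y - x = {p}" by (auto simp: card_1_singleton_iff)
    then show ?thesis using that[of p] by blast
  qed
  have "y \<in> set_pmf (teamwise_step X draw (x \<inter> y))"
    unfolding set_teamwise_step[OF z] using p y subset_P by (intro image_eqI[of _ _ p]) auto
  then have "cheapest (\<lambda>_. teamwise_step X draw) (x \<inter> y) y"
    unfolding cheapest_def Int_Diff Diff_cancel Int_empty_right card.empty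
    by (intro exI[of _ "pmf (teamwise_step X draw (x \<inter> y)) y"] conjI leading_const pmf_nonneg)
      (rule pmf_positive)
  moreover have "cheapest err x (x \<inter> y)" using err_cheapest x by simp
  ultimately have "cheapest (\<lambda>\<epsilon> x. bind_pmf (err \<epsilon> x) (teamwise_step X draw)) x y"
    by (intro cheapest_bind[OF finite_X finite_state err_resistant teamwise_resistant x y(1) z])
      (simp_all add: Int_Diff Diff_Int)
  then show ?thesis by (simp add: perturbed_step_def[abs_def])
qed

text \<open>All of \<open>x - y\<close> is destroyed in the first period. Each period forms one
  missing project of \<open>y\<close> at no further cost, and surplus periods redraw projects
  already present.\<close>

lemma steps_cheapest:
  assumes "x \<in> X" "y \<in> X" "y \<noteq> {}" "card (y - x) \<le> Suc n"
  shows "cheapest (\<lambda>\<epsilon>. steps (K \<epsilon>) (Suc n)) x y"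
  using assms(1,4)
proof (induction n arbitrary: x)
  case 0
  then show ?case using K_cheapest assms(2,3) by (simp add: bind_return_pmf')
next
  case (Suc n)
  obtain p where p: "p \<in> y" "y - x \<noteq> {} \<Longrightarrow> p \<in> y - x" using assms(3) by blast
  define z where "z = x \<inter> y \<union> {p}"
  have zy: "z \<subseteq> y" "z \<noteq> {}" using p by (auto simp: z_def)
  then have z: "z \<in> X" by (intro down_closed[OF assms(2)])
  \<comment> \<open>The whole cost is paid on the way to \<open>z\<close>; the remaining periods are
    free.\<close>
  have xz: "x - z = x - y" using p by (auto simp: z_def)
  have "card (z - x) \<le> card {p}" by (intro card_mono) (auto simp: z_def)
  then have 1: "cheapest K x z" using Suc.prems z zy by (intro K_cheapest) auto
  have "card (y - z) \<le> Suc n"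
  proof (cases "y - x = {}")
    case True
    then have "y - z = {}" by (auto simp: z_def)
    then show ?thesis by (metis card.empty le0)
  next
    case False
    then have "y - z = (y - x) - {p}" "p \<in> y - x" using p by (auto simp: z_def)
    then show ?thesis using Suc.prems(2) finite_state[OF assms(2)] by simp
  qed
  from Suc.IH[OF z this] have 2: "cheapest (\<lambda>\<epsilon>. steps (K \<epsilon>) (Suc n)) z y" .
  have "z - y = {}" using zy by auto
  then have "card (x - z) + card (z - y) = card (x - y)" by (simp only: xz card.empty)
  from cheapest_bind[OF finite_X finite_state K_resistant
      resistant_steps[OF finite_X finite_state K_resistant] Suc.prems(1) assms(2) z 1 2 this]
  show ?case by simp
qed

lemma stochastically_stable_eq_max_size: "stochastically_stable X K = max_size_states X"
proof -
  \<comment> \<open>The empty state is never entered, so positive \<open>n\<close>-step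
    probabilities can be expected only between the other states.\<close>
  define S where "S = X - {{}}"
  \<comment> \<open>Enough periods for all pairs at once, since \<open>card (y - x)\<close> is at
    most \<open>card P\<close>.\<close>
  define n where "n = Suc (card P)"
  define \<pi> where "\<pi> \<epsilon> = stationary_distribution X (K \<epsilon>)" for \<epsilon>
  have S: "finite S" "S \<noteq> {}"
    using finite_X P_nonempty by (auto simp: S_def dest!: singleton_in)
  have KS: "set_pmf (K \<epsilon> x) \<subseteq> S" if "x \<in> S" for \<epsilon> x
    using K_nonempty that by (simp add: S_def)
  have QS: "set_pmf (steps (K \<epsilon>) n x) \<subseteq> S" if "x \<in> S" for \<epsilon> x
    using set_pmf_steps[of S "K \<epsilon>"] KS that by blast
  have Q: "has_order (\<lambda>\<epsilon>. pmf (steps (K \<epsilon>) n x) y) (card (x - y))" if "x \<in> S" "y \<in> S" for x y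
  proof (rule cheapest_has_order)
    have "card (y - x) \<le> card P" using that subset_P finite_P by (intro card_mono) (auto simp: S_def)
    then show "cheapest (\<lambda>\<epsilon>. steps (K \<epsilon>) n) x y"
      unfolding n_def using that by (intro steps_cheapest) (auto simp: S_def)
  qed
  have "eventually (\<lambda>\<epsilon>. \<forall>x\<in>S. \<forall>y\<in>S. 0 < pmf (steps (K \<epsilon>) n x) y) (at_right 0)"
    by (intro eventually_ball_finite ballI S(1) has_order_imp_pos[OF Q])
  then have ev: "eventually (\<lambda>\<epsilon>. stationary S (K \<epsilon>) (\<pi> \<epsilon>) \<and> (\<forall>x\<in>S. 0 < pmf (\<pi> \<epsilon>) x)) (at_right 0)"
  proof eventually_elim
    case (elim \<epsilon>)
    have "\<exists>\<rho>. (\<forall>\<sigma>. stationary S (K \<epsilon>) \<sigma> \<longleftrightarrow> \<sigma> = \<rho>) \<and> (\<forall>x\<in>S. 0 < pmf \<rho> x)"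
      by (rule stationary_ex_unique[OF S KS]) (use elim in auto)
    then obtain \<rho> where \<rho>: "\<And>\<sigma>. stationary S (K \<epsilon>) \<sigma> \<longleftrightarrow> \<sigma> = \<rho>" "\<forall>x\<in>S. 0 < pmf \<rho> x"
      by blast
    \<comment> \<open>All mass has left the empty state after one period, so stationarity on
      \<open>X\<close> and on \<open>S\<close> coincide.\<close>
    have "stationary X (K \<epsilon>) \<sigma> \<longleftrightarrow> stationary S (K \<epsilon>) \<sigma>" for \<sigma>
    proof
      assume \<sigma>: "stationary X (K \<epsilon>) \<sigma>"
      have "(\<Union>x\<in>set_pmf \<sigma>. set_pmf (K \<epsilon> x)) \<subseteq> S"
        unfolding S_def using \<sigma> by (intro UN_least K_nonempty) (auto simp: stationary_def)
      then have "set_pmf (bind_pmf \<sigma> (K \<epsilon>)) \<subseteq> S" by simp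
      then show "stationary S (K \<epsilon>) \<sigma>"
        using \<sigma> unfolding stationary_def by (simp del: set_bind_pmf)
    qed (auto simp: stationary_def S_def)
    then have "\<pi> \<epsilon> = \<rho>" by (simp add: \<pi>_def stationary_distribution_def \<rho>(1))
    then show ?case using \<rho> by blast
  qed
  define c where "c x = real (card x)" for x :: "'p set"
  have ratio: "has_order (\<lambda>\<epsilon>. pmf (\<pi> \<epsilon>) x / pmf (\<pi> \<epsilon>) y) (c y - c x)" if xy: "x \<in> S" "y \<in> S" for x y
  proof -
    \<comment> \<open>The factor on the weight is compensated by dividing the row of
      \<open>x\<close> by the same power.\<close>
    define p where "p \<epsilon> x = pmf (\<pi> \<epsilon>) x * \<epsilon> powr c x" for \<epsilon> x
    have "has_order (\<lambda>\<epsilon>. p \<epsilon> x / p \<epsilon> y) 0"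
    proof (rule balanced_has_order[where K = "\<lambda>\<epsilon> x y. pmf (steps (K \<epsilon>) n x) y / \<epsilon> powr c x"
          and b = "\<lambda>x y. card (x - y) - c x", OF S])
      show "has_order (\<lambda>\<epsilon>. pmf (steps (K \<epsilon>) n x) y / \<epsilon> powr c x) (card (x - y) - c x)"
        if "x \<in> S" "y \<in> S" for x y
        by (intro has_order_divide Q that has_order_powr)
      \<comment> \<open>Both sides are minus the size of \<open>x \<inter> y\<close>.\<close>
      show "card (x - y) - c x = card (y - x) - c y" if "x \<in> S" "y \<in> S" for x y
      proof -
        have "card x = card (x \<inter> y) + card (x - y)" "card y = card (y \<inter> x) + card (y - x)"
          using that finite_state by (auto simp: S_def card_Int_Diff)
        then show ?thesis by (simp add: c_def Int_commute)
      qed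
      show "eventually (\<lambda>\<epsilon>. balanced S (\<lambda>x y. pmf (steps (K \<epsilon>) n x) y / \<epsilon> powr c x) (p \<epsilon>) \<and>
          (\<forall>x\<in>S. 0 < p \<epsilon> x)) (at_right 0)"
        using ev eventually_pos
      proof eventually_elim
        case (elim \<epsilon>)
        have "balanced S (\<lambda>x. pmf (steps (K \<epsilon>) n x)) (pmf (\<pi> \<epsilon>))"
          using stationary_steps[of S "K \<epsilon>" "\<pi> \<epsilon>" n] elim(1)
          by (simp add: stationary_iff_balanced[OF S(1) QS])
        then have "balanced S (\<lambda>x y. pmf (steps (K \<epsilon>) n x) y / \<epsilon> powr c x) (p \<epsilon>)"
          using elim(2) by (simp add: balanced_def p_def sum_divide_distrib[symmetric])
        then show ?case using elim by (simp add: p_def)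
      qed
    qed (use xy in auto)
    \<comment> \<open>Undoing the rescaling turns order 0 into the difference of the sizes.\<close>
    from has_order_mult[OF this has_order_powr[of "c y - c x"]]
    have "has_order (\<lambda>\<epsilon>. p \<epsilon> x / p \<epsilon> y * \<epsilon> powr (c y - c x)) (c y - c x)" by simp
    moreover have "eventually (\<lambda>\<epsilon>. p \<epsilon> x / p \<epsilon> y * \<epsilon> powr (c y - c x) = pmf (\<pi> \<epsilon>) x / pmf (\<pi> \<epsilon>) y) (at_right 0)"
      using eventually_pos by eventually_elim (simp add: p_def powr_diff)
    ultimately show ?thesis by (simp add: has_order_cong)
  qed
  define M where "M = Max (card ` X)"
  have "Max (card ` X) \<in> card ` X" using finite_X S by (intro Max_in) (auto simp: S_def)
  \<comment> \<open>A largest state serves as reference: all ratios to its weight have nonnegative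
    order, hence converge.\<close>
  then obtain y where y: "y \<in> X" "card y = M" by (auto simp: M_def)
  have le_M: "card x \<le> M" if "x \<in> X" for x using finite_X that by (simp add: M_def)
  have max_eq: "max_size_states X = {x \<in> X. card x = M}"
    unfolding max_size_states_def using y le_M by (auto intro: le_antisym)
  obtain p where "p \<in> P" using P_nonempty by blast
  then have M: "M > 0" using le_M[OF singleton_in, of p] by simp
  then have yS: "y \<in> S" using y by (auto simp: S_def)
  have "\<forall>x\<in>S. \<exists>r\<ge>0. ((\<lambda>\<epsilon>. pmf (\<pi> \<epsilon>) x / pmf (\<pi> \<epsilon>) y) \<longlongrightarrow> r) (at_right 0) \<and> (0 < r \<longleftrightarrow> card x = M)"
  proof
    fix x assume "x \<in> S"
    then have "0 \<le> c y - c x" "c y - c x = 0 \<longleftrightarrow> card x = M" using le_M y by (auto simp: c_def S_def)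
    with has_order_tendsto[OF ratio[OF \<open>x \<in> S\<close> yS]]
    show "\<exists>r\<ge>0. ((\<lambda>\<epsilon>. pmf (\<pi> \<epsilon>) x / pmf (\<pi> \<epsilon>) y) \<longlongrightarrow> r) (at_right 0) \<and> (0 < r \<longleftrightarrow> card x = M)" by auto
  qed
  then obtain r where r: "\<And>x. x \<in> S \<Longrightarrow> 0 \<le> r x" "\<And>x. x \<in> S \<Longrightarrow> 0 < r x \<longleftrightarrow> card x = M"
    "\<And>x. x \<in> S \<Longrightarrow> ((\<lambda>\<epsilon>. pmf (\<pi> \<epsilon>) x / pmf (\<pi> \<epsilon>) y) \<longlongrightarrow> r x) (at_right 0)" by metis
  define R where "R = (\<Sum>x\<in>S. r x)"
  have R: "R > 0" unfolding R_def using S r yS y by (intro sum_pos2[of S y]) auto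
  have lim: "((\<lambda>\<epsilon>. pmf (\<pi> \<epsilon>) x) \<longlongrightarrow> r x / R) (at_right 0)" if x: "x \<in> S" for x
  proof -
    \<comment> \<open>The ratios to the weight of \<open>y\<close> sum to its reciprocal, so
      dividing by their sum recovers the probabilities.\<close>
    have "((\<lambda>\<epsilon>. (pmf (\<pi> \<epsilon>) x / pmf (\<pi> \<epsilon>) y) / (\<Sum>x\<in>S. pmf (\<pi> \<epsilon>) x / pmf (\<pi> \<epsilon>) y)) \<longlongrightarrow> r x / R) (at_right 0)"
      unfolding R_def by (intro tendsto_divide tendsto_sum r x) (use R R_def in auto)
    moreover have "eventually (\<lambda>\<epsilon>. (pmf (\<pi> \<epsilon>) x / pmf (\<pi> \<epsilon>) y) / (\<Sum>x\<in>S. pmf (\<pi> \<epsilon>) x / pmf (\<pi> \<epsilon>) y)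
        = pmf (\<pi> \<epsilon>) x) (at_right 0)"
      using ev
    proof eventually_elim
      case (elim \<epsilon>)
      then have "(\<Sum>x\<in>S. pmf (\<pi> \<epsilon>) x) = 1" by (intro sum_pmf_eq_1 S) (simp add: stationary_def)
      moreover have "pmf (\<pi> \<epsilon>) y \<noteq> 0" using elim yS by force
      ultimately show ?case by (simp add: sum_divide_distrib[symmetric])
    qed
    ultimately show ?thesis by (rule Lim_transform_eventually)
  qed
  have "(\<exists>l>0. ((\<lambda>\<epsilon>. pmf (\<pi> \<epsilon>) x) \<longlongrightarrow> l) (at_right 0)) \<longleftrightarrow> card x = M" if x: "x \<in> X" for x
  proof (cases "x = {}")
    case True
    \<comment> \<open>The empty state carries no stationary mass, and it is not of maximal size
      because \<open>M > 0\<close>.\<close>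
    have "eventually (\<lambda>\<epsilon>. pmf (\<pi> \<epsilon>) x = 0) (at_right 0)"
      using ev
    proof eventually_elim
      case (elim \<epsilon>)
      then have "x \<notin> set_pmf (\<pi> \<epsilon>)" using True by (auto simp: stationary_def S_def)
      then show ?case by (simp add: set_pmf_iff)
    qed
    then have "((\<lambda>\<epsilon>. pmf (\<pi> \<epsilon>) x) \<longlongrightarrow> 0) (at_right 0)" by (rule tendsto_eventually)
    then have "\<not> (\<exists>l>0. ((\<lambda>\<epsilon>. pmf (\<pi> \<epsilon>) x) \<longlongrightarrow> l) (at_right 0))"
      using tendsto_unique[OF trivial_limit_at_right_real] by fastforce
    then show ?thesis using True M by simp
  next
    case False
    then have xS: "x \<in> S" using x by (simp add: S_def)
    have "(\<exists>l>0. ((\<lambda>\<epsilon>. pmf (\<pi> \<epsilon>) x) \<longlongrightarrow> l) (at_right 0)) \<longleftrightarrow> 0 < r x / R"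
      using lim[OF xS] tendsto_unique[OF trivial_limit_at_right_real] by metis
    then show ?thesis using r(2)[OF xS] R by (simp add: zero_less_divide_iff)
  qed
  then show ?thesis unfolding max_eq stochastically_stable_def \<pi>_def[symmetric] by blast
qed

end

section \<open>Feasible states of a team formation model\<close>

lemma finite_teams: "finite N \<Longrightarrow> finite (teams N w)"
  by (rule finite_subset[OF _ finite_PiE_dflt[of N "\<lambda>i. {..w i}" 0]])
    (auto simp: teams_def PiE_dflt_def)

text \<open>Dropping projects can only lower efforts and keeps one team per activity; a single team
  fits the endowments by the definition of \<open>teams\<close>.\<close>

lemma independence_system_feasible_states:
  assumes model: "team_formation_model N w A P" and P: "P \<noteq> {}"
  shows "independence_system P (feasible_states N w P)"
proof
  show fin: "finite P"
    using model finite_teams[of N w]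
    by (auto simp: team_formation_model_def intro: finite_subset[of P "A \<times> teams N w"])
  show "P \<noteq> {}" by fact
  show "x \<subseteq> P" if "x \<in> feasible_states N w P" for x
    using that by (simp add: feasible_states_def states_def)
  show "y \<in> feasible_states N w P" if x: "x \<in> feasible_states N w P" and y: "y \<subseteq> x" for x y
  proof -
    have "finite x" using x by (intro finite_subset[OF _ fin]) (simp add: feasible_states_def states_def)
    then have "effort y i \<le> effort x i" for i
      unfolding effort_def using y by (rule sum_mono2) simp
    then have "\<forall>i\<in>N. effort y i \<le> w i"
      using x by (auto simp: feasible_states_def intro: order_trans)
    moreover have "y \<in> states P"
      using x y by (simp add: feasible_states_def states_def) (meson subsetD subset_trans)
    ultimately show ?thesis by (simp add: feasible_states_def)
  qed
  show "{p} \<in> feasible_states N w P" if "p \<in> P" for p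
  proof -
    obtain a t where p: "p = (a, t)" by (cases p)
    have "t \<in> teams N w" using model that p by (auto simp: team_formation_model_def)
    then show ?thesis using that
      by (auto simp: feasible_states_def states_def effort_def teams_def p)
  qed
qed

theorem proposition3:
  fixes N :: "'i set" and w :: "'i \<Rightarrow> nat" and A :: "'a set"
    and P :: "('a, 'i) project set" and u :: "'i \<Rightarrow> ('a, 'i) state \<Rightarrow> real"
    and draw :: "('a, 'i) state \<Rightarrow> ('a, 'i) project pmf"
    and err :: "real \<Rightarrow> ('a, 'i) state \<Rightarrow> ('a, 'i) state pmf"
  defines "X \<equiv> feasible_states N w P"
  assumes "team_formation_model N w A P"
    and "\<And>x x' p i. x \<in> X \<Longrightarrow> x' \<in> X \<Longrightarrow> x' \<noteq> x \<Longrightarrow> p \<in> P \<Longrightarrow> x' = x \<union> {p} \<Longrightarrow>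
           i \<in> members N p \<Longrightarrow> u i x' > u i x"
    and "full_support_draw P X draw"
    and "err = destructive_scheme \<or>
         (\<exists>res. error_outcome P X res \<and> err = uniform_scheme P res)"
  shows "stochastically_stable X (perturbed_step X draw err) = max_size_states X"
proof -
  have "{} \<in> X" by (simp add: X_def feasible_states_def states_def effort_def)
  \<comment> \<open>The draw at the empty state is a probability distribution with support
    \<open>P\<close>, and such supports are nonempty.\<close>
  then have "P \<noteq> {}" using assms(4) set_pmf_not_empty by (fastforce simp: full_support_draw_def)
  then interpret independence_system P X
    unfolding X_def by (rule independence_system_feasible_states[OF assms(2)])
  have "resistant X err \<and> (\<forall>x z. x \<in> X \<longrightarrow> z \<subseteq> x \<longrightarrow> cheapest err x z)"
    using assms(5)
  proof
    assume "err = destructive_scheme"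
    then show ?thesis using destructive_resistant by simp
  next
    assume "\<exists>res. error_outcome P X res \<and> err = uniform_scheme P res"
    then obtain res where "error_outcome P X res" "err = uniform_scheme P res" by blast
    then show ?thesis using uniform_resistant by simp
  qed
  then interpret perturbed_teamwise P X draw err
    using assms(4) by unfold_locales auto
  show ?thesis by (rule stochastically_stable_eq_max_size)
qed

end
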